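(* Let $X$ be a compact Alexandroff topological space with at least two elements, equip $X^{\mathbb{N}}$ with the product topology, and let $\sigma:X^{\mathbb{N}}\to X^{\mathbb{N}}$, $(x_n)_{n\in\mathbb{N}}\mapsto(x_{n+1})_{n\in\mathbb{N}}$, be the one-sided shift. Then the following statements are equivalent: (a) $\sigma:X^{\mathbb{N}}\to X^{\mathbb{N}}$ is Li--Yorke chaotic; (b) there exist $x,y\in X^{\mathbb{N}}$ such that $(x,y)$ is a scrambled pair for $\sigma$; (c) there exist $x,y\in X^{\mathbb{N}}$ such that $(x,y)$ is not an asymptotic pair for $\sigma$; (d) there exist $a,b\in X$ such that $\overline{\{a\}}\cap\overline{\{b\}}=\varnothing$; (e) $\bigcap\{\overline{\{x\}}:x\in X\}=\varnothing$; (f) for all $z\in X$, $V(z)\neq X$.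
   Context: $\mathbb{N}=\{1,2,3,\ldots\}$. Compact means every open cover has a finite subcover; no separation axiom (such as Hausdorff) is assumed. A topological space $X$ is an Alexandroff space if the intersection of any nonempty collection of open subsets of $X$ is open; equivalently each $x\in X$ has a smallest open neighbourhood, denoted $V(x)$. For $A\subseteq X$, $\overline{A}$ is the closure of $A$ in $X$. For a set $Y$, $\Delta_Y=\{(y,y):y\in Y\}$. Let $Y$ be a compact topological space and $f:Y\to Y$ a continuous map. A pair $(x,y)\in Y\times Y$ is asymptotic if for each open neighbourhood $U$ of $\Delta_Y$ in $Y\times Y$ the set $\{n\in\mathbb{N}:(f^n(x),f^n(y))\notin U\}$ is finite. A pair $(x,y)\in Y\times Y$ is scrambled if both: (g-1) for each open neighbourhood $U$ of $\Delta_Y$ in $Y\times Y$, $\{n\in\mathbb{N}:(f^n(x),f^n(y))\in U\}\neq\varnothing$; and (g-2) there exists an open neighbourhood $U$ of $\Delta_Y$ in $Y\times Y$ such that $\{n\in\mathbb{N}:(f^n(x),f^n(y))\notin U\}$ is infinite. A subset $A\subseteq Y$ is scrambled if $(x,y)$ is a scrambled pair for all distinct $x,y\in A$. The map $f:Y\to Y$ is Li--Yorke chaotic if $Y$ has an uncountable scrambled subset. These notions are applied here with $Y=X^{\mathbb{N}}$ and $f=\sigma$. *)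

theory Defs
  imports "HOL-Analysis.Analysis"
begin

definition Alexandroff_space :: "'a topology \<Rightarrow> bool" where
  "Alexandroff_space X \<longleftrightarrow>
     (\<forall>\<U>. \<U> \<noteq> {} \<and> (\<forall>U\<in>\<U>. openin X U) \<longrightarrow> openin X (\<Inter>\<U>))"

text \<open>In an Alexandroff space the following set is open, hence it is the smallest
  open neighbourhood of \<open>z\<close>.\<close>

definition min_nbhd :: "'a topology \<Rightarrow> 'a \<Rightarrow> 'a set" where
  "min_nbhd X z = \<Inter>{U. openin X U \<and> z \<in> U}"

definition diag_nbhd :: "'b topology \<Rightarrow> ('b \<times> 'b) set \<Rightarrow> bool" where
  "diag_nbhd Y U \<longleftrightarrow> openin (prod_topology Y Y) U \<and> Id_on (topspace Y) \<subseteq> U"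

text \<open>In the following notions \<open>f\<close> is meant to be a continuous self-map of a compact
  space \<open>Y\<close>, and \<open>x\<close>, \<open>y\<close> to be points of \<open>Y\<close>. Times range over \<open>{1..}\<close>,
  so time \<open>0\<close> is excluded.\<close>

definition asymptotic_pair :: "'b topology \<Rightarrow> ('b \<Rightarrow> 'b) \<Rightarrow> 'b \<Rightarrow> 'b \<Rightarrow> bool" where
  "asymptotic_pair Y f x y \<longleftrightarrow>
     (\<forall>U. diag_nbhd Y U \<longrightarrow>
        finite {n::nat. n \<ge> 1 \<and> ((f ^^ n) x, (f ^^ n) y) \<notin> U})"

definition scrambled_pair :: "'b topology \<Rightarrow> ('b \<Rightarrow> 'b) \<Rightarrow> 'b \<Rightarrow> 'b \<Rightarrow> bool" where
  "scrambled_pair Y f x y \<longleftrightarrow>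
     (\<forall>U. diag_nbhd Y U \<longrightarrow>
        {n::nat. n \<ge> 1 \<and> ((f ^^ n) x, (f ^^ n) y) \<in> U} \<noteq> {}) \<and>
     (\<exists>U. diag_nbhd Y U \<and>
        infinite {n::nat. n \<ge> 1 \<and> ((f ^^ n) x, (f ^^ n) y) \<notin> U})"

definition scrambled_set :: "'b topology \<Rightarrow> ('b \<Rightarrow> 'b) \<Rightarrow> 'b set \<Rightarrow> bool" where
  "scrambled_set Y f A \<longleftrightarrow>
     A \<subseteq> topspace Y \<and> (\<forall>x\<in>A. \<forall>y\<in>A. x \<noteq> y \<longrightarrow> scrambled_pair Y f x y)"

definition Li_Yorke_chaotic :: "'b topology \<Rightarrow> ('b \<Rightarrow> 'b) \<Rightarrow> bool" where
  "Li_Yorke_chaotic Y f \<longleftrightarrow> (\<exists>A. scrambled_set Y f A \<and> uncountable A)"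

text \<open>Sequences are indexed by \<open>{1..}\<close>. As points of a product topology they are
  extensional functions (value \<^const>\<open>undefined\<close> at \<open>0\<close>), which is why the shift
  has to be restricted to the index set.\<close>

definition seq_space :: "'a topology \<Rightarrow> (nat \<Rightarrow> 'a) topology" where
  "seq_space X = product_topology (\<lambda>_. X) {1..}"

definition shift :: "(nat \<Rightarrow> 'a) \<Rightarrow> (nat \<Rightarrow> 'a)" where
  "shift x = restrict (\<lambda>n. x (n + 1)) {1..}"

text \<open>The shift is a continuous self-map of a compact space, as the notions above presuppose.\<close>

lemma compact_space_seq_space: "compact_space X \<Longrightarrow> compact_space (seq_space X)"
  unfolding seq_space_def by (simp add: compact_space_product_topology)

lemma continuous_map_shift: "continuous_map (seq_space X) (seq_space X) shift"
  unfolding seq_space_def continuous_map_componentwise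
  by (auto simp: shift_def intro!: continuous_map_product_projection)

end

theory Submission
  imports Defs
begin

text \<open>
  Since \<open>x \<in> X closure_of {a}\<close> means \<open>a \<in> min_nbhd X x\<close>, statement (e) is the negation of
  \<open>min_nbhd X z = topspace X\<close> for some \<open>z\<close>, and the negation of (d) says that the family of minimal
  neighbourhoods is upward directed; by compactness it then has \<open>topspace X\<close> as a member. If
  \<open>min_nbhd X z = topspace X\<close>, every open neighbourhood of the diagonal in the sequence space
  contains all pairs, since it contains the constant sequence \<open>z\<close> paired with itself, so every pair
  is asymptotic. Conversely, if \<open>a\<close> and \<open>b\<close> have disjoint closures, the complements of the closures
  yield a neighbourhood of the diagonal that misses \<open>(a, b)\<close>. One then codes subsets of the naturals by
  sequences of \<open>a\<close> and \<open>b\<close> in which \<open>b\<close> occurs only at powers of two: any two such sequences share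
  arbitrarily long blocks of \<open>a\<close>, and each bit is repeated infinitely often, so sequences of
  distinct sets differ infinitely often.
\<close>

section \<open>Minimal neighbourhoods and closures of points\<close>

lemma in_closure_of_singleton_iff:
  "x \<in> X closure_of {a} \<longleftrightarrow> x \<in> topspace X \<and> a \<in> min_nbhd X x"
  by (auto simp: in_closure_of min_nbhd_def)

lemma self_in_min_nbhd: "z \<in> min_nbhd X z"
  by (simp add: min_nbhd_def)

lemma min_nbhd_subset_open: "openin X U \<Longrightarrow> z \<in> U \<Longrightarrow> min_nbhd X z \<subseteq> U"
  by (auto simp: min_nbhd_def)

lemma min_nbhd_subset_topspace: "z \<in> topspace X \<Longrightarrow> min_nbhd X z \<subseteq> topspace X"
  by (simp add: min_nbhd_subset_open)

lemma openin_min_nbhd: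
  assumes "Alexandroff_space X" "z \<in> topspace X"
  shows "openin X (min_nbhd X z)"
proof -
  have "{U. openin X U \<and> z \<in> U} \<noteq> {}"
    using assms(2) openin_topspace by blast
  then show ?thesis
    using assms(1) unfolding Alexandroff_space_def min_nbhd_def by simp
qed

text \<open>This is the transitivity of the specialization preorder, in which the points of
  \<open>min_nbhd X z\<close> are those below \<open>z\<close>.\<close>

lemma min_nbhd_mono:
  assumes "x \<in> min_nbhd X z"
  shows "min_nbhd X x \<subseteq> min_nbhd X z"
  using assms by (auto simp: min_nbhd_def)

lemma disjoint_closures_if_no_min_nbhd_total:
  assumes compact: "compact_space X" and alex: "Alexandroff_space X"
    and proper: "\<And>z. z \<in> topspace X \<Longrightarrow> min_nbhd X z \<noteq> topspace X"
    and nonempty: "topspace X \<noteq> {}"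
  shows "\<exists>a\<in>topspace X. \<exists>b\<in>topspace X. X closure_of {a} \<inter> X closure_of {b} = {}"
proof (rule ccontr)
  assume no_disjoint: "\<not> ?thesis"
  \<comment> \<open>A common point of the two closures serves as \<open>z\<close>.\<close>
  have directed: "\<exists>z\<in>topspace X. a \<in> min_nbhd X z \<and> b \<in> min_nbhd X z"
    if "a \<in> topspace X" "b \<in> topspace X" for a b
  proof -
    have "X closure_of {a} \<inter> X closure_of {b} \<noteq> {}"
      using no_disjoint that by blast
    then show ?thesis
      using in_closure_of_singleton_iff[of _ X] by blast
  qed
  have finite_bound: "\<exists>z\<in>topspace X. F \<subseteq> min_nbhd X z" if "finite F" "F \<subseteq> topspace X" for F
    using that
  proof (induction F rule: finite_induct)
    case empty
    then show ?case using nonempty by blast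
  next
    case (insert a F)
    then obtain z where z: "z \<in> topspace X" "F \<subseteq> min_nbhd X z"
      by blast
    \<comment> \<open>A common bound of \<open>a\<close> and of the bound \<open>z\<close> of
      \<open>F\<close> bounds \<open>insert a F\<close>, by transitivity.\<close>
    obtain w where "w \<in> topspace X" "a \<in> min_nbhd X w" "z \<in> min_nbhd X w"
      using directed[of a z] insert.prems z(1) by blast
    then show ?case
      using z(2) min_nbhd_mono[of z X w] by blast
  qed
  \<comment> \<open>Finitely many minimal neighbourhoods cover \<open>X\<close>; a bound of their
    centres has a minimal neighbourhood containing all of them.\<close>
  have "topspace X \<subseteq> \<Union> (min_nbhd X ` topspace X)"
    using self_in_min_nbhd[of _ X] by blast
  moreover have "\<forall>U\<in>min_nbhd X ` topspace X. openin X U"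
    using openin_min_nbhd[OF alex] by blast
  ultimately obtain \<F> where \<F>: "finite \<F>" "\<F> \<subseteq> min_nbhd X ` topspace X" "topspace X \<subseteq> \<Union>\<F>"
    using compact unfolding compact_space_alt by meson
  then obtain F where F: "F \<subseteq> topspace X" "finite F" "\<F> = min_nbhd X ` F"
    by (meson finite_subset_image)
  obtain z where z: "z \<in> topspace X" "F \<subseteq> min_nbhd X z"
    using finite_bound[OF F(2,1)] by blast
  have "topspace X \<subseteq> min_nbhd X z"
  proof
    fix x assume "x \<in> topspace X"
    then obtain y where "y \<in> F" "x \<in> min_nbhd X y"
      using \<F>(3) F(3) by blast
    then show "x \<in> min_nbhd X z"
      using z(2) min_nbhd_mono[of y X z] by blast
  qed
  then show False
    using proper[OF z(1)] min_nbhd_subset_topspace[OF z(1)] by simp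
qed

text \<open>Over an empty carrier the intersection would be the whole type, hence the
  assumption.\<close>

lemma in_Inter_closures_iff_min_nbhd_total:
  assumes "topspace X \<noteq> {}"
  shows "z \<in> (\<Inter>x\<in>topspace X. X closure_of {x}) \<longleftrightarrow>
    z \<in> topspace X \<and> min_nbhd X z = topspace X"
proof -
  have "z \<in> (\<Inter>x\<in>topspace X. X closure_of {x}) \<longleftrightarrow>
      z \<in> topspace X \<and> topspace X \<subseteq> min_nbhd X z"
    using assms unfolding INT_iff in_closure_of_singleton_iff by blast
  then show ?thesis
    using min_nbhd_subset_topspace[of z X] by (simp add: set_eq_subset) blast
qed

lemma Inter_closures_empty_iff:
  assumes "topspace X \<noteq> {}"
  shows "(\<Inter>x\<in>topspace X. X closure_of {x}) = {} \<longleftrightarrow>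
    (\<forall>z\<in>topspace X. min_nbhd X z \<noteq> topspace X)"
  unfolding set_eq_iff[of _ "{}"] in_Inter_closures_iff_min_nbhd_total[OF assms] by auto

section \<open>The shift and neighbourhoods of the diagonal\<close>

lemma topspace_seq_space: "topspace (seq_space X) = PiE {1..} (\<lambda>_. topspace X)"
  by (simp add: seq_space_def)

lemma shift_in_seq_space: "x \<in> topspace (seq_space X) \<Longrightarrow> shift x \<in> topspace (seq_space X)"
  by (auto simp: topspace_seq_space shift_def PiE_iff)

lemma shift_funpow_in_seq_space:
  "x \<in> topspace (seq_space X) \<Longrightarrow> (shift ^^ n) x \<in> topspace (seq_space X)"
  by (induction n) (auto simp: shift_in_seq_space)

text \<open>Index 0 is excluded because \<open>shift\<close> puts \<open>undefined\<close>
  there.\<close>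

lemma shift_funpow_apply: "i \<ge> 1 \<Longrightarrow> (shift ^^ n) x i = x (i + n)"
  by (induction n arbitrary: i) (auto simp: shift_def)

text \<open>Around the constant sequence \<open>z\<close> a basic open set restricts only finitely
  many coordinates, and each of its open factors contains \<open>min_nbhd X z\<close>. Since
  \<open>U\<close> contains a product of two such sets, control of an initial segment
  suffices.\<close>

lemma diag_nbhd_seq_space_contains_cylinder:
  assumes "diag_nbhd (seq_space X) U" and z: "z \<in> topspace X"
  shows "\<exists>N. \<forall>x\<in>topspace (seq_space X). \<forall>y\<in>topspace (seq_space X).
           (\<forall>i\<in>{1..N}. x i \<in> min_nbhd X z \<and> y i \<in> min_nbhd X z) \<longrightarrow> (x, y) \<in> U"
proof -
  define c where "c = restrict (\<lambda>_::nat. z) {1..}"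
  have cyl: "\<exists>N. \<forall>x\<in>topspace (seq_space X). (\<forall>i\<in>{1..N}. x i \<in> min_nbhd X z) \<longrightarrow> x \<in> A"
    if "openin (seq_space X) A" "c \<in> A" for A
  proof -
    have "\<exists>B. finite {i \<in> {1..}. B i \<noteq> topspace X} \<and> (\<forall>i\<in>{1..}. openin X (B i)) \<and>
        c \<in> PiE {1..} B \<and> PiE {1..} B \<subseteq> A"
      using that unfolding seq_space_def openin_product_topology_alt by blast
    then obtain B where B: "finite {i \<in> {1..}. B i \<noteq> topspace X}" "\<forall>i\<in>{1..}. openin X (B i)"
        "c \<in> PiE {1..} B" "PiE {1..} B \<subseteq> A"
      by blast
    \<comment> \<open>\<open>N\<close> bounds the restricted coordinates; beyond it every value is
      allowed.\<close>
    obtain N where N: "\<forall>i\<in>{i \<in> {1..}. B i \<noteq> topspace X}. i \<le> N"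
      using B(1) finite_nat_set_iff_bounded_le by auto
    have "x \<in> A" if x: "x \<in> topspace (seq_space X)" "\<forall>i\<in>{1..N}. x i \<in> min_nbhd X z" for x
    proof -
      have "x i \<in> B i" if i: "i \<ge> 1" for i
      proof (cases "B i = topspace X")
        case True
        then show ?thesis using x(1) i by (auto simp: topspace_seq_space PiE_iff)
      next
        case False
        then have "x i \<in> min_nbhd X z" using N x(2) i by auto
        moreover have "z \<in> B i" using B(3) i by (auto simp: c_def PiE_iff)
        moreover have "openin X (B i)" using B(2) i by simp
        ultimately show ?thesis using min_nbhd_subset_open[of X "B i" z] by blast
      qed
      then have "x \<in> PiE {1..} B"
        using x(1) by (auto simp: topspace_seq_space PiE_iff)
      then show ?thesis using B(4) by blast
    qed
    then show ?thesis by blast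
  qed
  have "c \<in> topspace (seq_space X)"
    using z by (simp add: c_def topspace_seq_space)
  then have "openin (prod_topology (seq_space X) (seq_space X)) U" "(c, c) \<in> U"
    using assms(1) by (auto simp: diag_nbhd_def Id_on_def)
  then obtain A B where AB: "openin (seq_space X) A" "openin (seq_space X) B"
      "c \<in> A" "c \<in> B" "A \<times> B \<subseteq> U"
    unfolding openin_prod_topology_alt by metis
  obtain M where M:
      "\<forall>x\<in>topspace (seq_space X). (\<forall>i\<in>{1..M}. x i \<in> min_nbhd X z) \<longrightarrow> x \<in> A"
    using cyl[OF AB(1,3)] by blast
  obtain N where N:
      "\<forall>x\<in>topspace (seq_space X). (\<forall>i\<in>{1..N}. x i \<in> min_nbhd X z) \<longrightarrow> x \<in> B"
    using cyl[OF AB(2,4)] by blast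
  have "(x, y) \<in> U"
    if "x \<in> topspace (seq_space X)" "y \<in> topspace (seq_space X)"
      "\<forall>i\<in>{1..max M N}. x i \<in> min_nbhd X z \<and> y i \<in> min_nbhd X z" for x y
  proof -
    have "\<forall>i\<in>{1..M}. x i \<in> min_nbhd X z" "\<forall>i\<in>{1..N}. y i \<in> min_nbhd X z"
      using that(3) by auto
    then have "x \<in> A" "y \<in> B"
      using M[rule_format, OF that(1)] N[rule_format, OF that(2)] by simp_all
    then show ?thesis using AB(5) by blast
  qed
  then show ?thesis
    by (intro exI[of _ "max M N"]) simp
qed

text \<open>The cylinder condition holds for all pairs, so the set of exceptional times is even
  empty.\<close>

lemma asymptotic_pair_if_min_nbhd_total:
  assumes "z \<in> topspace X" "min_nbhd X z = topspace X"
    and xy: "x \<in> topspace (seq_space X)" "y \<in> topspace (seq_space X)"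
  shows "asymptotic_pair (seq_space X) shift x y"
proof -
  have "((shift ^^ n) x, (shift ^^ n) y) \<in> U" if U: "diag_nbhd (seq_space X) U" for U n
  proof -
    have "w i \<in> min_nbhd X z" if "w \<in> topspace (seq_space X)" "i \<ge> 1" for w i
      using that assms(2) by (auto simp: topspace_seq_space PiE_iff)
    then show ?thesis
      using diag_nbhd_seq_space_contains_cylinder[OF U assms(1)] shift_funpow_in_seq_space xy
      by (meson atLeastAtMost_iff)
  qed
  then show ?thesis
    by (simp add: asymptotic_pair_def)
qed

section \<open>Scrambled sequences coding sets of naturals\<close>

definition coding_seq :: "'a \<Rightarrow> 'a \<Rightarrow> nat set \<Rightarrow> nat \<Rightarrow> 'a" where
  "coding_seq a b S = restrict
     (\<lambda>n. if \<exists>j m. j \<in> S \<and> n = 2 ^ prod_encode (j, m) then b else a) {1..}"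

lemma coding_seq_in_seq_space:
  "a \<in> topspace X \<Longrightarrow> b \<in> topspace X \<Longrightarrow> coding_seq a b S \<in> topspace (seq_space X)"
  by (auto simp: coding_seq_def topspace_seq_space)

text \<open>The position determines \<open>j\<close> because powers of 2 and
  \<open>prod_encode\<close> are injective. The free parameter \<open>m\<close> supplies infinitely
  many copies of bit \<open>j\<close>.\<close>

lemma coding_seq_power:
  "coding_seq a b S (2 ^ prod_encode (j, m)) = (if j \<in> S then b else a)"
  by (auto simp: coding_seq_def)

text \<open>The position lies strictly between the consecutive powers \<open>2 ^ k\<close> and
  \<open>2 ^ Suc k\<close>, so it is not a power of 2.\<close>

lemma coding_seq_gap:
  assumes "1 \<le> i" "i < 2 ^ k"
  shows "coding_seq a b S (i + 2 ^ k) = a"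
proof -
  have "i + 2 ^ k \<noteq> 2 ^ l" for l :: nat
  proof
    assume eq: "i + 2 ^ k = 2 ^ l"
    then have "(2::nat) ^ k < 2 ^ l" "(2::nat) ^ l < 2 ^ Suc k"
      using assms unfolding power_Suc by linarith+
    then have "k < l" "l < Suc k"
      by (meson power_less_imp_less_exp one_less_numeral_iff semiring_norm(76))+
    then show False by simp
  qed
  then show ?thesis
    using assms by (auto simp: coding_seq_def)
qed

lemma inj_coding_seq:
  assumes "a \<noteq> b"
  shows "inj (coding_seq a b)"
proof (rule injI)
  fix S T assume "coding_seq a b S = coding_seq a b T"
  then have "j \<in> S \<longleftrightarrow> j \<in> T" for j
    using assms coding_seq_power[of a b S j 0] coding_seq_power[of a b T j 0]
    by (auto split: if_splits)
  then show "S = T" by blast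
qed

text \<open>As the closures are disjoint, their complements cover \<open>X\<close>, so the squares
  of the two cylinders over them at coordinate 1 cover the diagonal. A sequence with first entry
  \<open>a\<close> is outside the first cylinder, one with first entry \<open>b\<close> outside the
  second.\<close>

lemma diag_nbhd_avoiding_pair:
  assumes disj: "X closure_of {a} \<inter> X closure_of {b} = {}"
    and ab: "a \<in> topspace X" "b \<in> topspace X"
  shows "\<exists>U. diag_nbhd (seq_space X) U \<and> (\<forall>x y. {x 1, y 1} = {a, b} \<longrightarrow> (x, y) \<notin> U)"
proof -
  define C where "C p = {x \<in> topspace (seq_space X). x 1 \<in> topspace X - X closure_of {p}}" for p
  define U where "U = C a \<times> C a \<union> C b \<times> C b"
  have proj: "continuous_map (seq_space X) X (\<lambda>x. x 1)"
    unfolding seq_space_def by (rule continuous_map_product_projection) simp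
  have "openin (seq_space X) (C p)" for p
    unfolding C_def by (rule openin_continuous_map_preimage[OF proj]) auto
  then have "openin (prod_topology (seq_space X) (seq_space X)) U"
    unfolding U_def by (intro openin_Un) (simp_all add: openin_prod_Times_iff)
  moreover have "Id_on (topspace (seq_space X)) \<subseteq> U"
    using disj by (auto simp: U_def C_def topspace_seq_space PiE_iff)
  moreover have "(x, y) \<notin> U" if xy: "{x 1, y 1} = {a, b}" for x y
  proof -
    have "a \<in> X closure_of {a}" "b \<in> X closure_of {b}"
      using ab by (auto simp: in_closure_of)
    then show ?thesis
      using xy by (auto simp: U_def C_def doubleton_eq_iff)
  qed
  ultimately show ?thesis
    unfolding diag_nbhd_def by blast
qed

lemma scrambled_pair_coding_seq:
  assumes disj: "X closure_of {a} \<inter> X closure_of {b} = {}"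
    and ab: "a \<in> topspace X" "b \<in> topspace X" and "S \<noteq> T"
  shows "scrambled_pair (seq_space X) shift (coding_seq a b S) (coding_seq a b T)"
proof -
  let ?x = "coding_seq a b S" and ?y = "coding_seq a b T"
  have prox: "{n. n \<ge> 1 \<and> ((shift ^^ n) ?x, (shift ^^ n) ?y) \<in> U} \<noteq> {}"
    if U: "diag_nbhd (seq_space X) U" for U
  proof -
    obtain N where N: "\<forall>x\<in>topspace (seq_space X). \<forall>y\<in>topspace (seq_space X).
        (\<forall>i\<in>{1..N}. x i \<in> min_nbhd X a \<and> y i \<in> min_nbhd X a) \<longrightarrow> (x, y) \<in> U"
      using diag_nbhd_seq_space_contains_cylinder[OF U ab(1)] by blast
    \<comment> \<open>After \<open>2 ^ N\<close> shifts, index \<open>i\<close> reads position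
      \<open>i + 2 ^ N\<close>, which lies in a gap because
      \<open>i \<le> N < 2 ^ N\<close>.\<close>
    have block: "(shift ^^ (2 ^ N)) (coding_seq a b R) i \<in> min_nbhd X a" if "i \<in> {1..N}" for R i
    proof -
      have "i < 2 ^ N"
        using that less_exp[of N] by (meson atLeastAtMost_iff le_less_trans)
      then show ?thesis
        using that by (simp add: shift_funpow_apply coding_seq_gap self_in_min_nbhd)
    qed
    have "((shift ^^ (2 ^ N)) ?x, (shift ^^ (2 ^ N)) ?y) \<in> U"
      using N block ab by (simp add: shift_funpow_in_seq_space coding_seq_in_seq_space)
    moreover have "(2::nat) ^ N \<ge> 1" by simp
    ultimately show ?thesis by blast
  qed
  obtain U where U: "diag_nbhd (seq_space X) U" "\<And>x y. {x 1, y 1} = {a, b} \<Longrightarrow> (x, y) \<notin> U"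
    using diag_nbhd_avoiding_pair[OF disj ab] by blast
  obtain j where j: "j \<in> S \<longleftrightarrow> j \<notin> T"
    using \<open>S \<noteq> T\<close> by blast
  \<comment> \<open>After \<open>t m\<close> shifts, coordinate 1, on which \<open>U\<close> acts,
    shows position \<open>t m + 1\<close>, a copy of bit \<open>j\<close>. Taking
    \<open>Suc m\<close> makes the exponent positive, so that time 0 does not occur.\<close>
  define t :: "nat \<Rightarrow> nat" where "t m = 2 ^ prod_encode (j, Suc m) - 1" for m
  have pos: "prod_encode (j, Suc m) > 0" for m
    using le_prod_encode_2[of "Suc m" j] by linarith
  have t_Suc: "1 + t m = 2 ^ prod_encode (j, Suc m)" for m
    by (simp add: t_def)
  have t_ge: "t m \<ge> 1" for m
    using t_Suc[of m] self_le_power[of "2::nat" "prod_encode (j, Suc m)"] pos by simp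
  have "inj t"
  proof (rule injI)
    fix m n assume "t m = t n"
    then have "(2::nat) ^ prod_encode (j, Suc m) = 2 ^ prod_encode (j, Suc n)"
      using t_Suc by metis
    then show "m = n" by simp
  qed
  then have "infinite (range t)"
    by (rule range_inj_infinite)
  moreover have "range t \<subseteq> {n. n \<ge> 1 \<and> ((shift ^^ n) ?x, (shift ^^ n) ?y) \<notin> U}"
  proof clarify
    fix m
    have "{(shift ^^ t m) ?x 1, (shift ^^ t m) ?y 1} = {a, b}"
      using j by (auto simp: shift_funpow_apply[OF order_refl] t_Suc coding_seq_power
          simp del: One_nat_def)
    then show "1 \<le> t m \<and> ((shift ^^ t m) ?x, (shift ^^ t m) ?y) \<notin> U"
      using U(2) t_ge by blast
  qed
  ultimately have "infinite {n. n \<ge> 1 \<and> ((shift ^^ n) ?x, (shift ^^ n) ?y) \<notin> U}"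
    using finite_subset by blast
  then show ?thesis
    unfolding scrambled_pair_def using prox U(1) by blast
qed

text \<open>Each point lies in its own closure, so \<open>a\<close> and \<open>b\<close> differ and
  the coding is injective on the uncountable power set of the naturals.\<close>

lemma Li_Yorke_chaotic_if_disjoint_closures:
  assumes disj: "X closure_of {a} \<inter> X closure_of {b} = {}"
    and ab: "a \<in> topspace X" "b \<in> topspace X"
  shows "Li_Yorke_chaotic (seq_space X) shift"
proof -
  have "a \<noteq> b"
    using disj ab by (auto simp: in_closure_of)
  then have "inj (coding_seq a b)"
    by (rule inj_coding_seq)
  moreover have "uncountable (UNIV :: nat set set)"
    using Cantors_theorem[of "UNIV :: nat set"] by (simp add: uncountable_def)
  ultimately have "uncountable (range (coding_seq a b))"
    by (simp add: countable_image_inj_eq)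
  moreover have "scrambled_set (seq_space X) shift (range (coding_seq a b))"
    unfolding scrambled_set_def
  proof (intro conjI ballI impI)
    show "range (coding_seq a b) \<subseteq> topspace (seq_space X)"
      using coding_seq_in_seq_space[OF ab] by (rule image_subsetI)
    fix x y assume "x \<in> range (coding_seq a b)" "y \<in> range (coding_seq a b)" "x \<noteq> y"
    then obtain S T where ST: "x = coding_seq a b S" "y = coding_seq a b T" "S \<noteq> T"
      by blast
    then show "scrambled_pair (seq_space X) shift x y"
      using scrambled_pair_coding_seq[OF disj ab ST(3)] by simp
  qed
  ultimately show ?thesis
    by (auto simp: Li_Yorke_chaotic_def)
qed

section \<open>From chaos to non-asymptotic pairs, and the equivalences\<close>

lemma scrambled_pair_if_Li_Yorke_chaotic:
  assumes "Li_Yorke_chaotic Y f"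
  shows "\<exists>x\<in>topspace Y. \<exists>y\<in>topspace Y. scrambled_pair Y f x y"
proof -
  obtain A where A: "scrambled_set Y f A" "uncountable A"
    using assms by (auto simp: Li_Yorke_chaotic_def)
  obtain x where x: "x \<in> A"
    using A(2) by fastforce
  have "\<not> A \<subseteq> {x}"
    using A(2) countable_subset[of A "{x}"] by auto
  then obtain y where "y \<in> A" "y \<noteq> x" by blast
  then show ?thesis
    using x A(1) unfolding scrambled_set_def by blast
qed

text \<open>The second clause of \<open>scrambled_pair\<close> is the negation of
  \<open>asymptotic_pair\<close>.\<close>

lemma not_asymptotic_if_scrambled: "scrambled_pair Y f x y \<Longrightarrow> \<not> asymptotic_pair Y f x y"
  by (auto simp: scrambled_pair_def asymptotic_pair_def)

theorem theorem11:
  fixes X :: "'a topology"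
  assumes "compact_space X"
    and "Alexandroff_space X"
    and "\<exists>p\<in>topspace X. \<exists>q\<in>topspace X. p \<noteq> q"
  shows "(Li_Yorke_chaotic (seq_space X) shift \<longleftrightarrow>
            (\<exists>x\<in>topspace (seq_space X). \<exists>y\<in>topspace (seq_space X).
               scrambled_pair (seq_space X) shift x y)) \<and>
         (Li_Yorke_chaotic (seq_space X) shift \<longleftrightarrow>
            (\<exists>x\<in>topspace (seq_space X). \<exists>y\<in>topspace (seq_space X).
               \<not> asymptotic_pair (seq_space X) shift x y)) \<and>
         (Li_Yorke_chaotic (seq_space X) shift \<longleftrightarrow>
            (\<exists>a\<in>topspace X. \<exists>b\<in>topspace X.
               X closure_of {a} \<inter> X closure_of {b} = {})) \<and>
         (Li_Yorke_chaotic (seq_space X) shift \<longleftrightarrow>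
            (\<Inter>x\<in>topspace X. X closure_of {x}) = {}) \<and>
         (Li_Yorke_chaotic (seq_space X) shift \<longleftrightarrow>
            (\<forall>z\<in>topspace X. min_nbhd X z \<noteq> topspace X))"
proof -
  let ?Y = "seq_space X"
  let ?a = "Li_Yorke_chaotic ?Y shift"
  let ?b = "\<exists>x\<in>topspace ?Y. \<exists>y\<in>topspace ?Y. scrambled_pair ?Y shift x y"
  let ?c = "\<exists>x\<in>topspace ?Y. \<exists>y\<in>topspace ?Y. \<not> asymptotic_pair ?Y shift x y"
  let ?d = "\<exists>a\<in>topspace X. \<exists>b\<in>topspace X. X closure_of {a} \<inter> X closure_of {b} = {}"
  let ?e = "(\<Inter>x\<in>topspace X. X closure_of {x}) = {}"
  let ?f = "\<forall>z\<in>topspace X. min_nbhd X z \<noteq> topspace X"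
  have nonempty: "topspace X \<noteq> {}"
    using assms(3) by blast
  \<comment> \<open>The implications form the cycle a, b, c, f, d, a; statement e is attached to
    f.\<close>
  have ab: "?a \<Longrightarrow> ?b"
    by (rule scrambled_pair_if_Li_Yorke_chaotic)
  have bc: "?b \<Longrightarrow> ?c"
    by (meson not_asymptotic_if_scrambled)
  have cf: "?c \<Longrightarrow> ?f"
    by (meson asymptotic_pair_if_min_nbhd_total)
  have fd: "?f \<Longrightarrow> ?d"
    by (rule disjoint_closures_if_no_min_nbhd_total[OF assms(1,2) _ nonempty]) simp
  have da: "?d \<Longrightarrow> ?a"
    by (meson Li_Yorke_chaotic_if_disjoint_closures)
  have ef: "?e \<longleftrightarrow> ?f"
    by (rule Inter_closures_empty_iff[OF nonempty])
  have "?a \<longleftrightarrow> ?b"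
    by (rule iffI[OF ab da[OF fd[OF cf[OF bc]]]])
  moreover have "?a \<longleftrightarrow> ?c"
    by (rule iffI[OF bc[OF ab] da[OF fd[OF cf]]])
  moreover have "?a \<longleftrightarrow> ?d"
    by (rule iffI[OF fd[OF cf[OF bc[OF ab]]] da])
  moreover have "?a \<longleftrightarrow> ?f"
    by (rule iffI[OF cf[OF bc[OF ab]] da[OF fd]])
  ultimately show ?thesis
    unfolding ef by (intro conjI)
qed

end
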